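(* Let $\mathcal{C}\subseteq F^n$ be a generalized skew differential Goppa code with Goppa polynomial $g\in R=L[x;\sigma,\partial]$, positional points $\alpha_0,\dots,\alpha_{n-1}$, elements $\eta_0,\dots,\eta_{n-1}\in L^*$ and parity check polynomials $h_0,\dots,h_{n-1}$. Let $c\in\mathcal{C}$, let $e=\sum_{j=1}^{\nu}e_j\varepsilon_{k_j}\in F^n$ with $k_1,\dots,k_\nu$ distinct and all $e_j\neq 0$, let $y=c+e$, and let $s$, $\lambda$, $\omega$ be the associated syndrome, error locator and error evaluator polynomials. Then there exists $\kappa\in R$ such that $$\omega=\kappa g+\lambda s .$$ Assume moreover that $\nu\le t=\left\lfloor\frac{\deg g}{2}\right\rfloor$. Let $u_I,v_I,r_I$ be the Bezout coefficients returned by the left extended Euclidean algorithm with input $g$ and $s$, where $I$ is the index determined by the conditions $\deg r_{I-1}\ge t$ and $\deg r_I<t$. Then there exists $h\in R$ such that $\kappa=hu_I$, $\lambda=hv_I$ and $\omega=hr_I$.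
   Context: Ore polynomials. $L$ is a field, $\sigma$ an automorphism of $L$ of finite order, $\partial:L\to L$ a $\sigma$-derivation (additive, with $\partial(ab)=\sigma(a)\partial(b)+\partial(a)b$), and $R=L[x;\sigma,\partial]$ is the Ore polynomial ring: its elements are polynomials $\sum_i a_ix^i$ with $a_i\in L$, multiplied by the rule $xa=\sigma(a)x+\partial(a)$ for $a \in L$. $R$ is a left and right Euclidean domain. By convention $\deg 0=-\infty$. For $f_1,\dots,f_m\in R$, $[f_1,\dots,f_m]_\ell$ (least common left multiple) denotes a generator of $Rf_1\cap\dots\cap Rf_m$ (unique up to left multiplication by $L^*$; equal to $1$ for the empty family), and $(f_1,f_2)_r$ denotes a generator of $Rf_1+Rf_2$. Skew differential Goppa code. Let $F\subseteq L$ be a field extension, $0\ne g\in R$ invariant (i.e. $Rg=gR$), $\alpha_0,\dots,\alpha_{n-1}\in L$ different elements with $(x-\alpha_i,g)_r=1$ for all $i$, and $\eta_0,\dots,\eta_{n-1}\in L^*$. The parity check polynomials $h_i\in R$ are determined by $\deg h_i<\deg g$ and $(x-\alpha_i)h_i-1\in Rg$. The code is $\mathcal{C}=\{(c_0,\dots,c_{n-1})\in F^n : \sum_{i=0}^{n-1}h_i\eta_ic_i=0\}$. Syndrome, locator, evaluator. $\{\varepsilon_0,\dots,\varepsilon_{n-1}\}$ is the canonical basis of $F^n$. For $y=(y_0,\dots,y_{n-1})=c+e$ as in the claim: the syndrome polynomial is $s=\sum_{i=0}^{n-1}h_i\eta_iy_i$; the error locator polynomial is $\lambda=[\{x-\alpha_{k_j}: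 1\le j\le\nu\}]_\ell$; writing $\lambda=\rho_{k_j}(x-\alpha_{k_j})$ with $\rho_{k_j}\in R$, the error evaluator polynomial is $\omega=\sum_{j=1}^{\nu}\rho_{k_j}\eta_{k_j}e_j$. Left extended Euclidean algorithm with input $f,g'$ ($f\ne 0$): set $r_0=f$, $r_1=g'$, $u_0=1$, $u_1=0$, $v_0=0$, $v_1=1$; for $i\ge1$, as long as $r_i\ne0$, let $q_i,r_{i+1}$ be the unique elements of $R$ with $r_{i-1}=q_ir_i+r_{i+1}$, $\deg r_{i+1}<\deg r_i$, and put $u_{i+1}=u_{i-1}-q_iu_i$, $v_{i+1}=v_{i-1}-q_iv_i$. It stops at the first index with zero remainder, and the output is all triples $(u_i,v_i,r_i)$, including the one with zero remainder. In the claim $f=g$ (the Goppa polynomial) and $g'=s$. *)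

theory Defs
  imports "HOL-Computational_Algebra.Polynomial" "HOL-Library.Extended"
begin

definition is_subfield :: "'a::field set \<Rightarrow> bool" where
  "is_subfield F \<longleftrightarrow> 0 \<in> F \<and> 1 \<in> F \<and>
     (\<forall>a\<in>F. \<forall>b\<in>F. a + b \<in> F \<and> a * b \<in> F) \<and>
     (\<forall>a\<in>F. - a \<in> F \<and> inverse a \<in> F)"

text \<open>
  The left module \<open>L[x;\<sigma>,\<delta>]\<close> is carried by the type \<open>'a poly\<close>: the polynomial with
  coefficients \<open>a\<^sub>i\<close> stands for \<open>\<Sum>\<^sub>i a\<^sub>i x\<^sup>i\<close>, coefficients on the left. Addition,
  negation and constants are those of \<open>'a poly\<close>, and only the product differs. It is
  determined by \<open>x (\<Sum>\<^sub>i a\<^sub>i x\<^sup>i) = \<Sum>\<^sub>i (\<sigma> a\<^sub>i x\<^sup>i\<^sup>+\<^sup>1 + \<delta> a\<^sub>i x\<^sup>i)\<close>. The commutative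
  \<open>*\<close> of \<open>'a poly\<close> is never the product of the Ore polynomial ring.
\<close>

definition ore_X_mult :: "('a::field \<Rightarrow> 'a) \<Rightarrow> ('a \<Rightarrow> 'a) \<Rightarrow> 'a poly \<Rightarrow> 'a poly" where
  "ore_X_mult \<sigma> \<delta> q = pCons 0 (map_poly \<sigma> q) + map_poly \<delta> q"

definition ore_mult :: "('a::field \<Rightarrow> 'a) \<Rightarrow> ('a \<Rightarrow> 'a) \<Rightarrow> 'a poly \<Rightarrow> 'a poly \<Rightarrow> 'a poly" where
  "ore_mult \<sigma> \<delta> p q = (\<Sum>i\<le>degree p. smult (coeff p i) ((ore_X_mult \<sigma> \<delta> ^^ i) q))"

locale ore_polynomials =
  fixes \<sigma> \<delta> :: "'a::field \<Rightarrow> 'a"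
  assumes sigma_bij: "bij \<sigma>"
    and sigma_add: "\<sigma> (a + b) = \<sigma> a + \<sigma> b"
    and sigma_mult: "\<sigma> (a * b) = \<sigma> a * \<sigma> b"
    and sigma_one: "\<sigma> 1 = 1"
    and sigma_finite_order: "\<exists>m>0. \<sigma> ^^ m = id"
    and delta_add: "\<delta> (a + b) = \<delta> a + \<delta> b"
    and delta_mult: "\<delta> (a * b) = \<sigma> a * \<delta> b + \<delta> a * b"
begin

text \<open>\<open>ore_mult\<close> makes \<open>'a poly\<close> a ring in which \<open>x a = \<sigma> a x + \<delta> a\<close>.\<close>

lemma sigma_0 [simp]: "\<sigma> 0 = 0"
proof -
  have "\<sigma> 0 + 0 = \<sigma> 0 + \<sigma> 0"
    using sigma_add[of 0 0] by (simp only: add_0_right)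
  then show ?thesis
    by (simp only: add_left_cancel)
qed

lemma delta_0 [simp]: "\<delta> 0 = 0"
proof -
  have "\<delta> 0 + 0 = \<delta> 0 + \<delta> 0"
    using delta_add[of 0 0] by (simp only: add_0_right)
  then show ?thesis
    by (simp only: add_left_cancel)
qed

lemma delta_1 [simp]: "\<delta> 1 = 0"
proof -
  have "\<delta> 1 + 0 = \<delta> 1 + \<delta> 1"
    using delta_mult[of 1 1] by (simp only: sigma_one mult_1_left mult_1_right add_0_right)
  then show ?thesis
    by (simp only: add_left_cancel)
qed

abbreviation X where "X \<equiv> ore_X_mult \<sigma> \<delta>"

lemma coeff_X: "coeff (X p) i = (case i of 0 \<Rightarrow> 0 | Suc j \<Rightarrow> \<sigma> (coeff p j)) + \<delta> (coeff p i)"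
  by (simp add: ore_X_mult_def coeff_map_poly coeff_pCons split: nat.split)

lemma X_add: "X (p + q) = X p + X q"
  by (rule poly_eqI) (simp add: coeff_X sigma_add delta_add split: nat.split)

lemma X_0 [simp]: "X 0 = 0"
  by (rule poly_eqI) (simp add: coeff_X split: nat.split)

lemma X_sum: "X (sum f A) = (\<Sum>a\<in>A. X (f a))"
  by (induction A rule: infinite_finite_induct) (simp_all add: X_add)

lemma X_smult: "X (smult a p) = smult (\<sigma> a) (X p) + smult (\<delta> a) p"
  by (rule poly_eqI) (simp add: coeff_X sigma_mult delta_mult algebra_simps split: nat.split)

lemma smult_sum_poly: "smult a (sum f A) = (\<Sum>i\<in>A. smult a (f i))"
  for f :: "'b \<Rightarrow> 'a poly"
  by (induction A rule: infinite_finite_induct) (simp_all add: smult_add_right)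

lemma X_pow_0 [simp]: "(X ^^ i) 0 = 0"
  by (induction i) simp_all

lemma X_pow_add: "(X ^^ i) (p + q) = (X ^^ i) p + (X ^^ i) q"
  by (induction i) (simp_all add: X_add)

lemma X_pow_1: "(X ^^ i) 1 = monom 1 i"
proof (induction i)
  case (Suc i)
  have "X (monom 1 i) = monom 1 (Suc i)"
    by (rule poly_eqI) (auto simp: coeff_X sigma_one split: nat.split)
  with Suc show ?case by simp
qed simp

lemma ore_mult_bound:
  assumes "degree p \<le> n"
  shows "ore_mult \<sigma> \<delta> p q = (\<Sum>i\<le>n. smult (coeff p i) ((X ^^ i) q))"
  unfolding ore_mult_def
  by (rule sum.mono_neutral_left) (use assms in \<open>auto simp: coeff_eq_0\<close>)

lemma ore_mult_add_left:
  "ore_mult \<sigma> \<delta> (p + p') q = ore_mult \<sigma> \<delta> p q + ore_mult \<sigma> \<delta> p' q"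
proof -
  define n where "n = max (degree p) (degree p')"
  have "degree (p + p') \<le> n" "degree p \<le> n" "degree p' \<le> n"
    by (auto simp: n_def degree_add_le_max)
  then show ?thesis
    by (simp add: ore_mult_bound smult_add_left sum.distrib)
qed

lemma ore_mult_add_right:
  "ore_mult \<sigma> \<delta> p (q + q') = ore_mult \<sigma> \<delta> p q + ore_mult \<sigma> \<delta> p q'"
  by (simp add: ore_mult_def X_pow_add smult_add_right sum.distrib)

lemma ore_mult_0_left [simp]: "ore_mult \<sigma> \<delta> 0 q = 0"
  by (simp add: ore_mult_def)

lemma ore_mult_0_right [simp]: "ore_mult \<sigma> \<delta> p 0 = 0"
  by (simp add: ore_mult_def)

lemma ore_mult_1_left [simp]: "ore_mult \<sigma> \<delta> 1 q = q"
  by (simp add: ore_mult_def)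

lemma ore_mult_1_right [simp]: "ore_mult \<sigma> \<delta> p 1 = p"
  by (simp add: ore_mult_def X_pow_1 smult_monom poly_as_sum_of_monoms)

lemma ore_mult_const_left: "ore_mult \<sigma> \<delta> [:a:] q = smult a q"
  by (simp add: ore_mult_def)

lemma ore_mult_smult_left: "ore_mult \<sigma> \<delta> (smult a p) q = smult a (ore_mult \<sigma> \<delta> p q)"
proof -
  have "ore_mult \<sigma> \<delta> (smult a p) q = (\<Sum>i\<le>degree p. smult (coeff (smult a p) i) ((X ^^ i) q))"
    by (rule ore_mult_bound) (rule degree_smult_le)
  then show ?thesis
    by (simp add: ore_mult_def smult_sum_poly)
qed

lemma ore_mult_sum_left: "ore_mult \<sigma> \<delta> (sum f A) q = (\<Sum>a\<in>A. ore_mult \<sigma> \<delta> (f a) q)"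
  by (induction A rule: infinite_finite_induct) (simp_all add: ore_mult_add_left)

lemma ore_mult_X_left: "ore_mult \<sigma> \<delta> (X p) q = X (ore_mult \<sigma> \<delta> p q)"
proof -
  define n where "n = degree p"
  have deg: "degree (X p) \<le> Suc n"
    by (rule degree_le) (auto simp: coeff_X coeff_eq_0 n_def split: nat.split)
  have "ore_mult \<sigma> \<delta> (X p) q =
      (\<Sum>i\<le>Suc n. smult (case i of 0 \<Rightarrow> 0 | Suc j \<Rightarrow> \<sigma> (coeff p j)) ((X ^^ i) q)) +
      (\<Sum>i\<le>Suc n. smult (\<delta> (coeff p i)) ((X ^^ i) q))"
    by (simp only: ore_mult_bound[OF deg] coeff_X smult_add_left sum.distrib)
  also have "(\<Sum>i\<le>Suc n. smult (case i of 0 \<Rightarrow> 0 | Suc j \<Rightarrow> \<sigma> (coeff p j)) ((X ^^ i) q)) =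
      (\<Sum>i\<le>n. smult (\<sigma> (coeff p i)) (X ((X ^^ i) q)))"
    by (simp add: sum.atMost_Suc_shift del: sum.atMost_Suc)
  also have "(\<Sum>i\<le>Suc n. smult (\<delta> (coeff p i)) ((X ^^ i) q)) =
      (\<Sum>i\<le>n. smult (\<delta> (coeff p i)) ((X ^^ i) q))"
    by (simp add: n_def coeff_eq_0)
  finally show ?thesis
    by (simp add: ore_mult_def X_sum X_smult sum.distrib n_def)
qed

lemma ore_mult_assoc:
  "ore_mult \<sigma> \<delta> (ore_mult \<sigma> \<delta> p q) r = ore_mult \<sigma> \<delta> p (ore_mult \<sigma> \<delta> q r)"
proof -
  have "ore_mult \<sigma> \<delta> ((X ^^ i) q) r = (X ^^ i) (ore_mult \<sigma> \<delta> q r)" for i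
    by (induction i) (simp_all add: ore_mult_X_left)
  then show ?thesis
    by (simp add: ore_mult_def[of _ _ p] ore_mult_sum_left ore_mult_smult_left)
qed

lemma ore_commutation: "ore_mult \<sigma> \<delta> [:0, 1:] [:a:] = [:\<delta> a, \<sigma> a:]"
  by (simp add: ore_mult_def ore_X_mult_def map_poly_pCons)

end

definition ore_deg :: "'a::zero poly \<Rightarrow> nat extended" where
  "ore_deg p = (if p = 0 then Minf else Fin (degree p))"

definition left_multiples :: "('a::field \<Rightarrow> 'a) \<Rightarrow> ('a \<Rightarrow> 'a) \<Rightarrow> 'a poly \<Rightarrow> 'a poly set" where
  "left_multiples \<sigma> \<delta> f = {ore_mult \<sigma> \<delta> a f |a. True}"

definition right_multiples :: "('a::field \<Rightarrow> 'a) \<Rightarrow> ('a \<Rightarrow> 'a) \<Rightarrow> 'a poly \<Rightarrow> 'a poly set" where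
  "right_multiples \<sigma> \<delta> f = {ore_mult \<sigma> \<delta> f a |a. True}"

definition ore_invariant :: "('a::field \<Rightarrow> 'a) \<Rightarrow> ('a \<Rightarrow> 'a) \<Rightarrow> 'a poly \<Rightarrow> bool" where
  "ore_invariant \<sigma> \<delta> g \<longleftrightarrow> left_multiples \<sigma> \<delta> g = right_multiples \<sigma> \<delta> g"

definition is_gcrd ::
    "('a::field \<Rightarrow> 'a) \<Rightarrow> ('a \<Rightarrow> 'a) \<Rightarrow> 'a poly \<Rightarrow> 'a poly \<Rightarrow> 'a poly \<Rightarrow> bool" where
  "is_gcrd \<sigma> \<delta> d f1 f2 \<longleftrightarrow>
     left_multiples \<sigma> \<delta> d =
       {a + b |a b. a \<in> left_multiples \<sigma> \<delta> f1 \<and> b \<in> left_multiples \<sigma> \<delta> f2}"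

text \<open>The second conjunct fixes the normalisation \<open>1\<close> for the empty family.\<close>

definition is_lclm ::
    "('a::field \<Rightarrow> 'a) \<Rightarrow> ('a \<Rightarrow> 'a) \<Rightarrow> 'a poly \<Rightarrow> 'a poly set \<Rightarrow> bool" where
  "is_lclm \<sigma> \<delta> l S \<longleftrightarrow>
     left_multiples \<sigma> \<delta> l = (\<Inter>f\<in>S. left_multiples \<sigma> \<delta> f) \<and> (S = {} \<longrightarrow> l = 1)"

text \<open>The polynomial \<open>x - a\<close>.\<close>

definition X_minus :: "'a::field \<Rightarrow> 'a poly" where
  "X_minus a = [:- a, 1:]"

definition parity_check_poly ::
    "('a::field \<Rightarrow> 'a) \<Rightarrow> ('a \<Rightarrow> 'a) \<Rightarrow> 'a poly \<Rightarrow> 'a \<Rightarrow> 'a poly \<Rightarrow> bool" where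
  "parity_check_poly \<sigma> \<delta> g a h \<longleftrightarrow>
     ore_deg h < ore_deg g \<and> ore_mult \<sigma> \<delta> (X_minus a) h - 1 \<in> left_multiples \<sigma> \<delta> g"

text \<open>
  Vectors of length \<open>n\<close> are functions on \<open>nat\<close> of which only the values at \<open>i < n\<close> matter.
\<close>

definition syndrome ::
    "('a::field \<Rightarrow> 'a) \<Rightarrow> ('a \<Rightarrow> 'a) \<Rightarrow> nat \<Rightarrow> (nat \<Rightarrow> 'a poly) \<Rightarrow> (nat \<Rightarrow> 'a) \<Rightarrow>
      (nat \<Rightarrow> 'a) \<Rightarrow> 'a poly" where
  "syndrome \<sigma> \<delta> n h \<eta> y = (\<Sum>i<n. ore_mult \<sigma> \<delta> (h i) [:\<eta> i * y i:])"

definition skew_goppa_code ::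
    "('a::field \<Rightarrow> 'a) \<Rightarrow> ('a \<Rightarrow> 'a) \<Rightarrow> 'a set \<Rightarrow> nat \<Rightarrow> (nat \<Rightarrow> 'a poly) \<Rightarrow> (nat \<Rightarrow> 'a) \<Rightarrow>
      (nat \<Rightarrow> 'a) set" where
  "skew_goppa_code \<sigma> \<delta> F n h \<eta> =
     {c. (\<forall>i<n. c i \<in> F) \<and> (\<Sum>i<n. ore_mult \<sigma> \<delta> (h i) [:\<eta> i * c i:]) = 0}"

text \<open>Quotient and remainder with \<open>f = q g + r\<close> and \<open>deg r < deg g\<close>, for \<open>g \<noteq> 0\<close>.\<close>

definition left_divmod ::
    "('a::field \<Rightarrow> 'a) \<Rightarrow> ('a \<Rightarrow> 'a) \<Rightarrow> 'a poly \<Rightarrow> 'a poly \<Rightarrow> 'a poly \<times> 'a poly" where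
  "left_divmod \<sigma> \<delta> f g =
     (THE (q, r). f = ore_mult \<sigma> \<delta> q g + r \<and> ore_deg r < ore_deg g)"

text \<open>
  The triple \<open>(u\<^sub>i, v\<^sub>i, r\<^sub>i)\<close> of the left extended Euclidean algorithm with input \<open>f\<close>, \<open>g\<close>.
  Only the indices satisfying \<open>left_eea_output\<close> are meaningful: past the first zero
  remainder, \<open>left_divmod\<close> divides by zero and is unspecified.
\<close>

fun left_eea ::
    "('a::field \<Rightarrow> 'a) \<Rightarrow> ('a \<Rightarrow> 'a) \<Rightarrow> 'a poly \<Rightarrow> 'a poly \<Rightarrow> nat \<Rightarrow>
      'a poly \<times> 'a poly \<times> 'a poly" where
  "left_eea \<sigma> \<delta> f g 0 = (1, 0, f)"
| "left_eea \<sigma> \<delta> f g (Suc 0) = (0, 1, g)"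
| "left_eea \<sigma> \<delta> f g (Suc (Suc i)) =
     (let (u0, v0, r0) = left_eea \<sigma> \<delta> f g i;
          (u1, v1, r1) = left_eea \<sigma> \<delta> f g (Suc i);
          (q, r2) = left_divmod \<sigma> \<delta> r0 r1
      in (u0 - ore_mult \<sigma> \<delta> q u1, v0 - ore_mult \<sigma> \<delta> q v1, r2))"

definition eea_u where "eea_u \<sigma> \<delta> f g i = fst (left_eea \<sigma> \<delta> f g i)"
definition eea_v where "eea_v \<sigma> \<delta> f g i = fst (snd (left_eea \<sigma> \<delta> f g i))"
definition eea_r where "eea_r \<sigma> \<delta> f g i = snd (snd (left_eea \<sigma> \<delta> f g i))"

definition left_eea_output ::
    "('a::field \<Rightarrow> 'a) \<Rightarrow> ('a \<Rightarrow> 'a) \<Rightarrow> 'a poly \<Rightarrow> 'a poly \<Rightarrow> nat \<Rightarrow> bool" where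
  "left_eea_output \<sigma> \<delta> f g i \<longleftrightarrow> (\<forall>j. 1 \<le> j \<and> j < i \<longrightarrow> eea_r \<sigma> \<delta> f g j \<noteq> 0)"

definition is_stop_index ::
    "('a::field \<Rightarrow> 'a) \<Rightarrow> ('a \<Rightarrow> 'a) \<Rightarrow> 'a poly \<Rightarrow> 'a poly \<Rightarrow> nat \<Rightarrow> nat \<Rightarrow> bool" where
  "is_stop_index \<sigma> \<delta> f g t I \<longleftrightarrow>
     1 \<le> I \<and> left_eea_output \<sigma> \<delta> f g I \<and>
     ore_deg (eea_r \<sigma> \<delta> f g (I - 1)) \<ge> Fin t \<and> ore_deg (eea_r \<sigma> \<delta> f g I) < Fin t"

end

theory Submission
  imports Defs
begin

text \<open>
  The key equation \<open>\<omega> = \<kappa> g + \<lambda> s\<close> comes from \<open>(x - \<alpha>\<^sub>i) h\<^sub>i \<in> 1 + R g\<close> and the fact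
  that \<open>g a \<in> R g\<close> for every constant \<open>a\<close>. For the comparison with the Euclidean algorithm,
  choose \<open>a \<noteq> 0\<close> and \<open>b\<close> with \<open>a \<lambda> = b v\<^sub>I\<close> and \<open>deg a \<le> deg v\<^sub>I\<close>. Since
  \<open>deg v\<^sub>I + deg r\<^sub>I\<^sub>-\<^sub>1 \<le> deg g\<close>, both \<open>a \<omega>\<close> and \<open>b r\<^sub>I\<close> have degree less than \<open>deg g\<close>;
  they are congruent modulo \<open>R g\<close>, hence equal, and so \<open>a \<kappa> = b u\<^sub>I\<close>. The matrix with rows
  \<open>(u\<^sub>I, v\<^sub>I)\<close> and \<open>(u\<^sub>I\<^sub>+\<^sub>1, v\<^sub>I\<^sub>+\<^sub>1)\<close> is invertible, so \<open>u\<^sub>I x + v\<^sub>I y = 1\<close> for some \<open>x\<close>, \<open>y\<close>.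
  Then \<open>b = b (u\<^sub>I x + v\<^sub>I y) = a (\<kappa> x + \<lambda> y)\<close> is a right multiple \<open>a h\<close>, and \<open>a\<close> cancels
  on the left.
\<close>

section \<open>Comparing degrees, with the zero polynomial below all others\<close>

lemma ore_deg_less_iff:
  "ore_deg p < ore_deg q \<longleftrightarrow> q \<noteq> 0 \<and> (p = 0 \<or> degree p < degree q)"
  by (auto simp: ore_deg_def less_extended_def)

lemma ore_deg_less_Fin_iff: "ore_deg p < Fin t \<longleftrightarrow> p = 0 \<or> degree p < t"
  by (auto simp: ore_deg_def less_extended_def)

lemma ore_deg_sum_less:
  assumes "\<And>i. i \<in> A \<Longrightarrow> ore_deg (f i) < Fin t"
  shows "ore_deg (sum f A) < Fin t"
proof (cases "sum f A = 0")
  case False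
  then obtain i where "i \<in> A" "f i \<noteq> 0"
    by (meson sum.not_neutral_contains_not_neutral)
  \<comment> \<open>A nonzero summand forces \<open>t > 0\<close>, so the strict bound can be
    replaced by \<open>t - 1\<close>, for which a bound on sums of polynomials exists.\<close>
  with assms have "t > 0"
    by (fastforce simp: ore_deg_less_Fin_iff)
  with assms have "degree (f i) \<le> t - 1" if "i \<in> A" for i
    using that by (fastforce simp: ore_deg_less_Fin_iff)
  moreover have "finite A"
    using False by (meson sum.infinite)
  ultimately have "degree (sum f A) \<le> t - 1"
    by (intro degree_sum_le)
  with \<open>t > 0\<close> have "degree (sum f A) < t"
    by linarith
  then show ?thesis
    by (simp add: ore_deg_less_Fin_iff)
qed (simp add: ore_deg_less_Fin_iff)

subsection \<open>Degrees and left division\<close>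

context ore_polynomials
begin

abbreviation ore_times (infixl "\<odot>" 70) where "p \<odot> q \<equiv> ore_mult \<sigma> \<delta> p q"

lemma ore_mult_minus_left: "(- p) \<odot> q = - (p \<odot> q)"
  using ore_mult_add_left[of p "- p" q] by (simp add: eq_neg_iff_add_eq_0 add.commute)

lemma ore_mult_minus_right: "p \<odot> (- q) = - (p \<odot> q)"
  using ore_mult_add_right[of p q "- q"] by (simp add: eq_neg_iff_add_eq_0 add.commute)

lemma ore_mult_diff_left: "(p - p') \<odot> q = p \<odot> q - p' \<odot> q"
  using ore_mult_add_left[of p "- p'" q] by (simp add: ore_mult_minus_left)

lemma ore_mult_diff_right: "p \<odot> (q - q') = p \<odot> q - p \<odot> q'"
  using ore_mult_add_right[of p q "- q'"] by (simp add: ore_mult_minus_right)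

lemma ore_mult_sum_right: "p \<odot> sum f A = (\<Sum>a\<in>A. p \<odot> f a)"
  by (induction A rule: infinite_finite_induct) (simp_all add: ore_mult_add_right)

lemmas ore_ring_simps = ore_mult_add_left ore_mult_add_right ore_mult_diff_left
  ore_mult_diff_right ore_mult_minus_left ore_mult_minus_right ore_mult_assoc

lemma sigma_eq_0_iff [simp]: "\<sigma> a = 0 \<longleftrightarrow> a = 0"
  using sigma_bij sigma_0 by (metis bij_pointE)

text \<open>The coefficient of \<open>X q\<close> one above the degree of \<open>q\<close> is the
  image under \<sigma> of the leading one, nonzero because \<sigma> is injective.\<close>

lemma degree_X:
  assumes "q \<noteq> 0"
  shows "X q \<noteq> 0" "degree (X q) = Suc (degree q)"
proof -
  have nz: "coeff (X q) (Suc (degree q)) \<noteq> 0"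
    using assms by (simp add: coeff_X coeff_eq_0)
  then show "X q \<noteq> 0"
    by auto
  have "degree (X q) \<le> Suc (degree q)"
    by (rule degree_le) (auto simp: coeff_X coeff_eq_0 split: nat.split)
  with nz show "degree (X q) = Suc (degree q)"
    by (simp add: le_antisym le_degree)
qed

lemma degree_X_pow:
  assumes "q \<noteq> 0"
  shows "(X ^^ i) q \<noteq> 0 \<and> degree ((X ^^ i) q) = degree q + i"
  by (induction i) (use assms in \<open>auto simp: degree_X\<close>)

text \<open>Only the term \<open>i = degree p\<close> of the product reaches this degree. Hence
  degrees add and there are no zero divisors.\<close>

lemma coeff_ore_mult_degree_sum:
  assumes "p \<noteq> 0" "q \<noteq> 0"
  shows "coeff (p \<odot> q) (degree p + degree q) \<noteq> 0"
proof -
  have "coeff (p \<odot> q) (degree p + degree q) =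
      (\<Sum>i\<le>degree p. coeff p i * coeff ((X ^^ i) q) (degree p + degree q))"
    by (simp add: ore_mult_def coeff_sum)
  also have "\<dots> = (\<Sum>i\<in>{degree p}. coeff p i * coeff ((X ^^ i) q) (degree p + degree q))"
    using degree_X_pow[OF assms(2)] by (intro sum.mono_neutral_right) (auto simp: coeff_eq_0)
  also have "\<dots> = lead_coeff p * lead_coeff ((X ^^ degree p) q)"
    using degree_X_pow[OF assms(2)] by (simp add: add.commute)
  also have "\<dots> \<noteq> 0"
    using assms(1) degree_X_pow[OF assms(2), of "degree p"] by (metis mult_eq_0_iff leading_coeff_0_iff)
  finally show ?thesis .
qed

lemma degree_ore_mult_le: "degree (p \<odot> q) \<le> degree p + degree q"
proof (cases "q = 0")
  case False
  have "degree (smult (coeff p i) ((X ^^ i) q)) \<le> degree p + degree q" if "i \<le> degree p" for i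
    using degree_X_pow[OF False, of i] degree_smult_le[of "coeff p i" "(X ^^ i) q"] that by simp
  then show ?thesis
    unfolding ore_mult_def by (intro degree_sum_le) auto
qed simp

lemma ore_mult_eq_0_iff: "p \<odot> q = 0 \<longleftrightarrow> p = 0 \<or> q = 0"
  using coeff_ore_mult_degree_sum[of p q] by fastforce

lemma degree_ore_mult:
  assumes "p \<noteq> 0" "q \<noteq> 0"
  shows "degree (p \<odot> q) = degree p + degree q"
  by (simp add: assms coeff_ore_mult_degree_sum degree_ore_mult_le le_antisym le_degree)

lemma ore_mult_left_cancel: "p \<noteq> 0 \<Longrightarrow> p \<odot> q = p \<odot> q' \<longleftrightarrow> q = q'"
  by (metis ore_mult_diff_right ore_mult_eq_0_iff right_minus_eq)

lemma left_multiple_eq_0: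
  assumes "ore_deg (q \<odot> g) < ore_deg g"
  shows "q = 0"
  using assms degree_ore_mult[of q g] by (fastforce simp: ore_deg_less_iff ore_mult_eq_0_iff)

lemma left_division:
  assumes "g \<noteq> 0"
  shows "\<exists>q r. f = q \<odot> g + r \<and> ore_deg r < ore_deg g"
\<comment> \<open>The shift by one makes the passage from a nonzero constant to 0 a decrease
  too.\<close>
proof (induction "if f = 0 then 0 else Suc (degree f)" arbitrary: f rule: less_induct)
  case less
  show ?case
  proof (cases "ore_deg f < ore_deg g")
    case True
    then show ?thesis
      by (intro exI[of _ 0] exI[of _ f]) simp
  next
    case False
    with assms have f: "f \<noteq> 0" "degree g \<le> degree f"
      by (auto simp: ore_deg_less_iff)
    \<comment> \<open>Each left factor x applies \<sigma> to the leading coefficient, so the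
      quotient term is scaled by the leading coefficient of \<open>m\<close>, not of
      \<open>g\<close>.\<close>
    define m where "m = (X ^^ (degree f - degree g)) g"
    have m: "m \<noteq> 0" "degree m = degree f"
      using degree_X_pow[OF assms, of "degree f - degree g"] f by (auto simp: m_def)
    define k where "k = smult (lead_coeff f / lead_coeff m) ((X ^^ (degree f - degree g)) 1)"
    have k: "k \<odot> g = smult (lead_coeff f / lead_coeff m) m"
    proof -
      have "(X ^^ i) 1 \<odot> g = (X ^^ i) g" for i
        by (induction i) (simp_all add: ore_mult_X_left)
      then show ?thesis
        by (simp add: k_def m_def ore_mult_smult_left)
    qed
    have c: "coeff (f - k \<odot> g) (degree f) = 0"
      using m by (simp add: k) (metis leading_coeff_0_iff)
    have "degree (f - k \<odot> g) \<le> degree f"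
      unfolding k using m by (intro degree_diff_le) (simp_all add: degree_smult_le)
    moreover have "degree (f - k \<odot> g) \<noteq> degree f" if "f - k \<odot> g \<noteq> 0"
      using c that by (metis leading_coeff_0_iff)
    ultimately have "(if f - k \<odot> g = 0 then 0 else Suc (degree (f - k \<odot> g)))
        < (if f = 0 then 0 else Suc (degree f))"
      using f by auto
    from less[OF this] obtain q r where "f - k \<odot> g = q \<odot> g + r" "ore_deg r < ore_deg g"
      by blast
    then have "f = (q + k) \<odot> g + r \<and> ore_deg r < ore_deg g"
      by (simp add: ore_mult_add_left algebra_simps)
    then show ?thesis
      by blast
  qed
qed

lemma left_division_unique:
  assumes "f = q \<odot> g + r" "ore_deg r < ore_deg g"
    and "f = q' \<odot> g + r'" "ore_deg r' < ore_deg g"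
  shows "q = q' \<and> r = r'"
proof -
  have eq: "(q - q') \<odot> g = r' - r"
    using assms(1,3) by (simp add: ore_mult_diff_left algebra_simps)
  have "ore_deg (r' - r) < ore_deg g"
    using assms(2,4) by (auto simp: ore_deg_less_iff intro: degree_diff_less)
  then have "q - q' = 0"
    using eq left_multiple_eq_0[of "q - q'" g] by simp
  with eq show ?thesis
    by simp
qed

text \<open>Existence and uniqueness of the division give the definite description its
  meaning.\<close>

lemma left_divmod:
  assumes "g \<noteq> 0"
  shows "f = fst (left_divmod \<sigma> \<delta> f g) \<odot> g + snd (left_divmod \<sigma> \<delta> f g)"
    and "ore_deg (snd (left_divmod \<sigma> \<delta> f g)) < ore_deg g"
proof -
  obtain q r where qr: "f = q \<odot> g + r" "ore_deg r < ore_deg g"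
    using left_division[OF assms] by blast
  have "left_divmod \<sigma> \<delta> f g = (q, r)"
    unfolding left_divmod_def
    by (rule the_equality) (use qr left_division_unique in blast)+
  with qr show "f = fst (left_divmod \<sigma> \<delta> f g) \<odot> g + snd (left_divmod \<sigma> \<delta> f g)"
    "ore_deg (snd (left_divmod \<sigma> \<delta> f g)) < ore_deg g"
    by auto
qed

subsection \<open>Common left multiples\<close>

text \<open>Euclidean descent: if \<open>f = q v + r\<close> and \<open>a v = b r\<close>, then
  \<open>b f = (b q + a) v\<close>. Comparing degrees in \<open>a v = b r\<close> gives deg b = deg
  a + deg v - deg r, which is at most deg v since deg a is at most deg r.\<close>

lemma left_ore_condition:
  assumes "v \<noteq> 0"
  shows "\<exists>a b. a \<noteq> 0 \<and> degree a \<le> degree v \<and> a \<odot> f = b \<odot> v"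
  using assms
proof (induction "degree v" arbitrary: f v rule: less_induct)
  case less
  obtain q r where qr: "f = q \<odot> v + r" "ore_deg r < ore_deg v"
    using left_division[OF less.prems] by blast
  show ?case
  proof (cases "r = 0")
    case True
    with qr show ?thesis
      by (intro exI[of _ 1] exI[of _ q]) simp
  next
    case False
    with qr have "degree r < degree v"
      by (simp add: ore_deg_less_iff)
    from less.hyps[OF this False, of v] obtain a b
      where ab: "a \<noteq> 0" "degree a \<le> degree r" "a \<odot> v = b \<odot> r"
      by blast
    with less.prems have "b \<noteq> 0"
      by (metis ore_mult_0_left ore_mult_eq_0_iff)
    moreover have "degree b \<le> degree v"
      using ab degree_ore_mult[OF \<open>a \<noteq> 0\<close> less.prems] degree_ore_mult[OF \<open>b \<noteq> 0\<close> False] by simp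
    moreover have "b \<odot> f = (b \<odot> q + a) \<odot> v"
      using ab by (simp add: qr ore_ring_simps)
    ultimately show ?thesis
      by blast
  qed
qed

text \<open>The point \<open>a\<close> is free: the product is reduced modulo x - a, and the last
  constant is the remainder.\<close>

lemma X_minus_times_const:
  "X_minus b \<odot> [:c:] = smult (\<sigma> c) (X_minus a) + [:\<sigma> c * a + \<delta> c - b * c:]"
  by (simp add: X_minus_def ore_mult_def ore_X_mult_def map_poly_pCons)

text \<open>
  If \<open>f\<close> leaves the remainder \<open>c \<noteq> 0\<close> modulo \<open>x - a\<close>, then \<open>(x - a\<^sup>c) f\<close> is a multiple of
  \<open>x - a\<close>, where \<open>a\<^sup>c = (\<sigma> c a + \<delta> c) / c\<close> is the conjugate of \<open>a\<close> by \<open>c\<close>.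
\<close>

lemma common_left_multiple_insert:
  assumes "f \<noteq> 0"
  shows "\<exists>p. p \<noteq> 0 \<and> degree p \<le> 1 \<and> p \<odot> f \<in> left_multiples \<sigma> \<delta> (X_minus a)"
proof -
  have nz: "X_minus a \<noteq> 0" "degree (X_minus a) = 1" for a :: 'a
    by (simp_all add: X_minus_def)
  obtain q r where qr: "f = q \<odot> X_minus a + r" "ore_deg r < ore_deg (X_minus a)"
    using left_division nz by blast
  then have "degree r = 0"
    by (auto simp: ore_deg_less_iff nz)
  then obtain c where r: "r = [:c:]"
    by (rule degree_eq_zeroE)
  show ?thesis
  proof (cases "c = 0")
    case True
    with qr r show ?thesis
      by (intro exI[of _ 1]) (auto simp: left_multiples_def)
  next
    case False
    define b where "b = (\<sigma> c * a + \<delta> c) / c"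
    have "X_minus b \<odot> [:c:] = smult (\<sigma> c) (X_minus a)"
      unfolding X_minus_times_const[of b c a] using False by (simp add: b_def)
    then have "X_minus b \<odot> f = (X_minus b \<odot> q + [:\<sigma> c:]) \<odot> X_minus a"
      by (simp add: qr r ore_ring_simps ore_mult_const_left)
    then show ?thesis
      using nz by (intro exI[of _ "X_minus b"]) (auto simp: left_multiples_def)
  qed
qed

lemma left_multiples_closed: "q \<in> left_multiples \<sigma> \<delta> f \<Longrightarrow> p \<odot> q \<in> left_multiples \<sigma> \<delta> f"
  by (auto simp: left_multiples_def ore_mult_assoc[symmetric])

text \<open>Each new point costs a left factor of degree at most 1, and left factors preserve the
  multiples already achieved.\<close>

lemma common_left_multiple:
  assumes "finite A"
  shows "\<exists>f. f \<noteq> 0 \<and> degree f \<le> card A \<and> (\<forall>a\<in>A. f \<in> left_multiples \<sigma> \<delta> (X_minus a))"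
  using assms
proof induction
  case empty
  show ?case
    by (intro exI[of _ 1]) simp
next
  case (insert a A)
  then obtain f where f: "f \<noteq> 0" "degree f \<le> card A"
    "\<forall>a\<in>A. f \<in> left_multiples \<sigma> \<delta> (X_minus a)"
    by blast
  obtain p where p: "p \<noteq> 0" "degree p \<le> 1" "p \<odot> f \<in> left_multiples \<sigma> \<delta> (X_minus a)"
    using common_left_multiple_insert[OF f(1)] by blast
  have "p \<odot> f \<noteq> 0" "degree (p \<odot> f) \<le> card (insert a A)"
    using insert.hyps f p degree_ore_mult_le[of p f] by (auto simp: ore_mult_eq_0_iff)
  with f p show ?case
    by (intro exI[of _ "p \<odot> f"]) (auto intro: left_multiples_closed)
qed

text \<open>The common left multiple built above is a left multiple of \<open>l\<close>, so it
  bounds the degree of \<open>l\<close>.\<close>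

lemma degree_lclm_le:
  assumes "is_lclm \<sigma> \<delta> l (X_minus ` A)" "finite A"
  shows "l \<noteq> 0 \<and> degree l \<le> card A"
proof -
  obtain f where f: "f \<noteq> 0" "degree f \<le> card A" "\<forall>a\<in>A. f \<in> left_multiples \<sigma> \<delta> (X_minus a)"
    using common_left_multiple[OF assms(2)] by blast
  then have "f \<in> left_multiples \<sigma> \<delta> l"
    using assms(1) by (auto simp: is_lclm_def)
  then obtain q where "f = q \<odot> l"
    by (auto simp: left_multiples_def)
  with f degree_ore_mult[of q l] show ?thesis
    by (auto simp: ore_mult_eq_0_iff)
qed

subsection \<open>The extended Euclidean algorithm\<close>

lemma eea_0 [simp]: "eea_u \<sigma> \<delta> f g 0 = 1" "eea_v \<sigma> \<delta> f g 0 = 0" "eea_r \<sigma> \<delta> f g 0 = f"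
  and eea_1 [simp]: "eea_u \<sigma> \<delta> f g (Suc 0) = 0" "eea_v \<sigma> \<delta> f g (Suc 0) = 1"
    "eea_r \<sigma> \<delta> f g (Suc 0) = g"
  by (simp_all add: eea_u_def eea_v_def eea_r_def)

text \<open>The index is that of the dividend, one less than in the usual numbering by the
  divisor.\<close>

definition eea_q :: "'a poly \<Rightarrow> 'a poly \<Rightarrow> nat \<Rightarrow> 'a poly" where
  "eea_q f g i = fst (left_divmod \<sigma> \<delta> (eea_r \<sigma> \<delta> f g i) (eea_r \<sigma> \<delta> f g (Suc i)))"

lemma eea_Suc_Suc:
  "eea_u \<sigma> \<delta> f g (Suc (Suc i)) = eea_u \<sigma> \<delta> f g i - eea_q f g i \<odot> eea_u \<sigma> \<delta> f g (Suc i)"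
  "eea_v \<sigma> \<delta> f g (Suc (Suc i)) = eea_v \<sigma> \<delta> f g i - eea_q f g i \<odot> eea_v \<sigma> \<delta> f g (Suc i)"
  "eea_r \<sigma> \<delta> f g (Suc (Suc i)) =
    snd (left_divmod \<sigma> \<delta> (eea_r \<sigma> \<delta> f g i) (eea_r \<sigma> \<delta> f g (Suc i)))"
  by (simp_all add: eea_u_def eea_v_def eea_r_def eea_q_def Let_def split_beta)

lemma eea_r_Suc_Suc:
  assumes "eea_r \<sigma> \<delta> f g (Suc i) \<noteq> 0"
  shows "eea_r \<sigma> \<delta> f g i = eea_q f g i \<odot> eea_r \<sigma> \<delta> f g (Suc i) + eea_r \<sigma> \<delta> f g (Suc (Suc i))"
    and "ore_deg (eea_r \<sigma> \<delta> f g (Suc (Suc i))) < ore_deg (eea_r \<sigma> \<delta> f g (Suc i))"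
  using left_divmod[OF assms, of "eea_r \<sigma> \<delta> f g i"] by (simp_all add: eea_Suc_Suc eea_q_def)

text \<open>
  The matrix with rows \<open>(u\<^sub>i, v\<^sub>i)\<close> and \<open>(u\<^sub>i\<^sub>+\<^sub>1, v\<^sub>i\<^sub>+\<^sub>1)\<close> is a product of elementary ones; its
  right inverse has the columns \<open>(x, y)\<close> and \<open>(z, w)\<close>.
\<close>

lemma eea_right_inverse:
  "\<exists>x y z w.
     eea_u \<sigma> \<delta> f g i \<odot> x + eea_v \<sigma> \<delta> f g i \<odot> y = 1 \<and>
     eea_u \<sigma> \<delta> f g i \<odot> z + eea_v \<sigma> \<delta> f g i \<odot> w = 0 \<and>
     eea_u \<sigma> \<delta> f g (Suc i) \<odot> x + eea_v \<sigma> \<delta> f g (Suc i) \<odot> y = 0 \<and>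
     eea_u \<sigma> \<delta> f g (Suc i) \<odot> z + eea_v \<sigma> \<delta> f g (Suc i) \<odot> w = 1"
proof (induction i)
  case 0
  show ?case
    by (intro exI[of _ 1] exI[of _ 0]) simp
next
  case (Suc i)
  define u v u' v' q where defs: "u = eea_u \<sigma> \<delta> f g i" "v = eea_v \<sigma> \<delta> f g i"
    "u' = eea_u \<sigma> \<delta> f g (Suc i)" "v' = eea_v \<sigma> \<delta> f g (Suc i)" "q = eea_q f g i"
  obtain x y z w where *: "u \<odot> x + v \<odot> y = 1" "u \<odot> z + v \<odot> w = 0"
      "u' \<odot> x + v' \<odot> y = 0" "u' \<odot> z + v' \<odot> w = 1"
    using Suc.IH by (auto simp: defs)
  \<comment> \<open>The new columns \<open>(x q + z, y q + w)\<close> and \<open>(x, y)\<close> are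
    the old inverse times the inverse of the elementary matrix with rows (0, 1) and (1, -q). This
    works for any \<open>q\<close>, so row \<open>Suc i\<close> may lie past a zero
    remainder.\<close>
  have comb: "p \<odot> (x \<odot> q + z) + p' \<odot> (y \<odot> q + w) = (p \<odot> x + p' \<odot> y) \<odot> q + (p \<odot> z + p' \<odot> w)"
    for p p'
    by (simp add: ore_ring_simps algebra_simps)
  have row: "(u - q \<odot> u') \<odot> a + (v - q \<odot> v') \<odot> b = (u \<odot> a + v \<odot> b) - q \<odot> (u' \<odot> a + v' \<odot> b)"
    for a b
    by (simp add: ore_ring_simps algebra_simps)
  have "u' \<odot> (x \<odot> q + z) + v' \<odot> (y \<odot> q + w) = 1 \<and> u' \<odot> x + v' \<odot> y = 0 \<and>
    (u - q \<odot> u') \<odot> (x \<odot> q + z) + (v - q \<odot> v') \<odot> (y \<odot> q + w) = 0 \<and>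
    (u - q \<odot> u') \<odot> x + (v - q \<odot> v') \<odot> y = 1"
    by (simp only: row) (simp add: comb *)
  then show ?case
    unfolding eea_Suc_Suc defs by blast
qed

lemma eea_bezout:
  assumes "left_eea_output \<sigma> \<delta> f g i"
  shows "eea_r \<sigma> \<delta> f g i = eea_u \<sigma> \<delta> f g i \<odot> f + eea_v \<sigma> \<delta> f g i \<odot> g"
  using assms
proof (induction i rule: induct_nat_012)
  case (ge2 i)
  have out: "left_eea_output \<sigma> \<delta> f g i" "left_eea_output \<sigma> \<delta> f g (Suc i)"
      "eea_r \<sigma> \<delta> f g (Suc i) \<noteq> 0"
    using ge2.prems by (auto simp: left_eea_output_def)
  have "eea_r \<sigma> \<delta> f g (Suc (Suc i)) =
      eea_r \<sigma> \<delta> f g i - eea_q f g i \<odot> eea_r \<sigma> \<delta> f g (Suc i)"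
    using eea_r_Suc_Suc(1)[OF out(3)] by simp
  also have "\<dots> = eea_u \<sigma> \<delta> f g (Suc (Suc i)) \<odot> f + eea_v \<sigma> \<delta> f g (Suc (Suc i)) \<odot> g"
    unfolding ge2.IH(1)[OF out(1)] ge2.IH(2)[OF out(2)]
    by (simp add: eea_Suc_Suc(1,2) ore_ring_simps algebra_simps)
  finally show ?case .
qed simp_all

text \<open>For \<open>i = 0\<close> the two inputs are compared, hence the degree hypothesis; later
  steps compare a remainder with its divisor.\<close>

lemma eea_r_decreasing:
  assumes "left_eea_output \<sigma> \<delta> f g (Suc i)" "ore_deg g < ore_deg f"
  shows "ore_deg (eea_r \<sigma> \<delta> f g (Suc i)) < ore_deg (eea_r \<sigma> \<delta> f g i)"
proof (cases i)
  case (Suc j)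
  then have "eea_r \<sigma> \<delta> f g (Suc j) \<noteq> 0"
    using assms(1) by (auto simp: left_eea_output_def)
  with Suc show ?thesis
    using eea_r_Suc_Suc(2) by blast
qed (use assms(2) in simp)

lemma left_eea_output_antimono:
  "left_eea_output \<sigma> \<delta> f g j \<Longrightarrow> i \<le> j \<Longrightarrow> left_eea_output \<sigma> \<delta> f g i"
  by (auto simp: left_eea_output_def)

lemma eea_r_antimono:
  assumes "left_eea_output \<sigma> \<delta> f g j" "ore_deg g < ore_deg f" "i \<le> j"
  shows "ore_deg (eea_r \<sigma> \<delta> f g j) \<le> ore_deg (eea_r \<sigma> \<delta> f g i)"
  using assms(3,1)
proof (induction rule: dec_induct)
  case (step m)
  then have "ore_deg (eea_r \<sigma> \<delta> f g (Suc m)) < ore_deg (eea_r \<sigma> \<delta> f g m)"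
    "ore_deg (eea_r \<sigma> \<delta> f g m) \<le> ore_deg (eea_r \<sigma> \<delta> f g i)"
    using eea_r_decreasing assms(2) left_eea_output_antimono[of f g "Suc m" m] by auto
  then show ?case
    by order
qed simp

text \<open>Only the first conjunct is of interest; the second one makes the induction work.\<close>

lemma degree_eea_v:
  assumes "left_eea_output \<sigma> \<delta> f g (Suc i)" "ore_deg g < ore_deg f"
  shows "degree (eea_v \<sigma> \<delta> f g (Suc i)) + degree (eea_r \<sigma> \<delta> f g i) \<le> degree f \<and>
    degree (eea_v \<sigma> \<delta> f g i) + degree (eea_r \<sigma> \<delta> f g i) \<le> degree f"
  using assms(1)
proof (induction i)
  case (Suc i)
  let ?r = "eea_r \<sigma> \<delta> f g" and ?v = "eea_v \<sigma> \<delta> f g" and ?q = "eea_q f g i"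
  have out: "left_eea_output \<sigma> \<delta> f g (Suc i)" and nz: "?r (Suc i) \<noteq> 0"
    using Suc.prems by (auto simp: left_eea_output_def)
  note IH = Suc.IH[OF out]
  have dec: "degree (?r (Suc i)) < degree (?r i)"
    using eea_r_decreasing[OF out assms(2)] nz by (simp add: ore_deg_less_iff)
  \<comment> \<open>This lets the induction hypothesis trade the degree of \<open>?r i\<close> for
    those of \<open>?q\<close> and \<open>?r (Suc i)\<close>.\<close>
  have "degree ?q + degree (?r (Suc i)) \<le> degree (?r i)"
  proof (cases "?q = 0")
    case False
    have "?q \<odot> ?r (Suc i) = ?r i - ?r (Suc (Suc i))"
      using eea_r_Suc_Suc(1)[OF nz] by simp
    moreover have "degree (?r (Suc (Suc i))) \<le> degree (?r i)"
      using eea_r_Suc_Suc(2)[OF nz] dec by (auto simp: ore_deg_less_iff)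
    ultimately have "degree (?q \<odot> ?r (Suc i)) \<le> degree (?r i)"
      by (simp add: degree_diff_le)
    then show ?thesis
      by (simp add: degree_ore_mult[OF False nz])
  qed (use dec in simp)
  then have "degree (?q \<odot> ?v (Suc i)) + degree (?r (Suc i)) \<le> degree f"
    using IH degree_ore_mult_le[of ?q "?v (Suc i)"] by linarith
  moreover have "degree (?v (Suc (Suc i))) \<le> max (degree (?v i)) (degree (?q \<odot> ?v (Suc i)))"
    unfolding eea_Suc_Suc by (rule degree_diff_le_max)
  ultimately show ?case
    using IH dec by linarith
qed simp

section \<open>Uniqueness and existence of the stopping index\<close>

lemma stop_index_unique:
  assumes "is_stop_index \<sigma> \<delta> f g t I" "is_stop_index \<sigma> \<delta> f g t J" "ore_deg g < ore_deg f"
  shows "I = J"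
proof -
  have False if I: "is_stop_index \<sigma> \<delta> f g t I" and J: "is_stop_index \<sigma> \<delta> f g t J" and "I < J"
    for I J
  proof -
    have "left_eea_output \<sigma> \<delta> f g (J - 1)"
      using J left_eea_output_antimono by (auto simp: is_stop_index_def)
    \<comment> \<open>As \<open>I\<close> is at most \<open>J - 1\<close>, remainder
      \<open>J - 1\<close> is already below \<open>t\<close>, against the choice of
      \<open>J\<close>.\<close>
    then have "ore_deg (eea_r \<sigma> \<delta> f g (J - 1)) \<le> ore_deg (eea_r \<sigma> \<delta> f g I)"
      using eea_r_antimono assms(3) \<open>I < J\<close> by simp
    then show False
      using I J unfolding is_stop_index_def by (meson leD le_less_trans order_trans)
  qed
  with assms show ?thesis
    by (meson linorder_neqE_nat)
qed

lemma stop_index_exists: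
  assumes "ore_deg g < ore_deg f" "t \<le> degree f"
  shows "\<exists>I. is_stop_index \<sigma> \<delta> f g t I"
proof -
  let ?r = "eea_r \<sigma> \<delta> f g"
  define P where "P i \<longleftrightarrow> ore_deg (?r i) < Fin t" for i
  have "\<exists>i. P i"
  proof (rule ccontr)
    \<comment> \<open>Otherwise no remainder vanishes and the degrees fall forever.\<close>
    assume notP: "\<nexists>i. P i"
    then have nz: "?r i \<noteq> 0" for i
      by (auto simp: P_def ore_deg_less_Fin_iff)
    then have "ore_deg (?r (Suc i)) < ore_deg (?r i)" for i
      by (intro eea_r_decreasing assms(1)) (simp add: left_eea_output_def)
    with nz have "degree (?r (Suc i)) < degree (?r i)" for i
      by (simp add: ore_deg_less_iff)
    then have "degree (?r i) + i \<le> degree f" for i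
    proof (induction i)
      case (Suc i)
      with Suc.prems[of i] show ?case
        by fastforce
    qed simp
    from this[of "Suc (degree f)"] show False
      by simp
  qed
  define I where "I = (LEAST i. P i)"
  have least: "\<not> P i" if "i < I" for i
    using that by (auto simp: I_def dest: not_less_Least)
  have "\<not> P 0"
    using assms by (auto simp: P_def ore_deg_less_Fin_iff ore_deg_less_iff)
  have "P I"
    using \<open>\<exists>i. P i\<close> by (auto simp: I_def intro: LeastI_ex)
  with \<open>\<not> P 0\<close> have "1 \<le> I"
    by (cases I) auto
  \<comment> \<open>By minimality all earlier remainders fail \<open>P\<close>, hence are
    nonzero.\<close>
  moreover have "left_eea_output \<sigma> \<delta> f g I"
    using least by (auto simp: left_eea_output_def P_def ore_deg_less_Fin_iff)
  ultimately show ?thesis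
    using \<open>P I\<close> least[of "I - 1"] by (auto simp: is_stop_index_def P_def not_less)
qed

section \<open>Low-degree Bezout triples as left multiples of the one at the stopping index\<close>

lemma eea_recovers_bezout_triple:
  assumes stop: "is_stop_index \<sigma> \<delta> f g t I"
    and deg: "ore_deg g < ore_deg f" "2 * t \<le> degree f"
    and w: "w = k \<odot> f + l \<odot> g" "ore_deg w < Fin t"
    and l: "l \<noteq> 0" "degree l \<le> t"
  shows "\<exists>h. k = h \<odot> eea_u \<sigma> \<delta> f g I \<and> l = h \<odot> eea_v \<sigma> \<delta> f g I \<and> w = h \<odot> eea_r \<sigma> \<delta> f g I"
proof -
  define u v r where defs: "u = eea_u \<sigma> \<delta> f g I" "v = eea_v \<sigma> \<delta> f g I" "r = eea_r \<sigma> \<delta> f g I"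
  have I: "1 \<le> I" "left_eea_output \<sigma> \<delta> f g I" "ore_deg (eea_r \<sigma> \<delta> f g (I - 1)) \<ge> Fin t"
    "ore_deg r < Fin t"
    using stop by (auto simp: is_stop_index_def defs)
  have "f \<noteq> 0"
    using deg by (simp add: ore_deg_less_iff)
  have r: "r = u \<odot> f + v \<odot> g"
    using eea_bezout[OF I(2)] by (simp add: defs)
  have "t \<le> degree (eea_r \<sigma> \<delta> f g (I - 1))"
    using I(3) by (metis linorder_not_less ore_deg_less_Fin_iff)
  then have v: "degree v + t \<le> degree f"
    using degree_eea_v[of f g "I - 1"] I deg(1) by (simp add: defs)
  obtain x y where xy: "u \<odot> x + v \<odot> y = 1"
    using eea_right_inverse[of f g I] by (auto simp: defs)
  \<comment> \<open>If \<open>v = 0\<close>, then \<open>r = u f\<close> has degree below that of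
    \<open>f\<close>, so \<open>u = 0\<close> too, which contradicts \<open>xy\<close>.\<close>
  have "v \<noteq> 0"
  proof
    assume "v = 0"
    with r I(4) deg(2) have "ore_deg (u \<odot> f) < ore_deg f"
      using \<open>f \<noteq> 0\<close> by (auto simp: ore_deg_less_iff ore_deg_less_Fin_iff)
    then have "u = 0"
      by (rule left_multiple_eq_0)
    with \<open>v = 0\<close> xy show False
      by simp
  qed
  then obtain a b where ab: "a \<noteq> 0" "degree a \<le> degree v" "a \<odot> l = b \<odot> v"
    using left_ore_condition by blast
  then have "b \<noteq> 0"
    using l(1) by (metis ore_mult_0_left ore_mult_eq_0_iff)
  have b: "degree b \<le> t"
    using degree_ore_mult[OF \<open>a \<noteq> 0\<close> l(1)] degree_ore_mult[OF \<open>b \<noteq> 0\<close> \<open>v \<noteq> 0\<close>] ab l(2) by simp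
  \<comment> \<open>The bounds are deg v + t for \<open>a w\<close> and 2t for \<open>b r\<close>,
    both strict. The zero cases are set apart because \<open>f\<close> may be constant when
    \<open>t = 0\<close>.\<close>
  have "degree (a \<odot> w) < degree f" if "w \<noteq> 0"
    using degree_ore_mult_le[of a w] that w(2) ab(2) v by (simp add: ore_deg_less_Fin_iff)
  moreover have "degree (b \<odot> r) < degree f" if "r \<noteq> 0"
    using degree_ore_mult_le[of b r] that I(4) b deg(2) by (simp add: ore_deg_less_Fin_iff)
  ultimately have "ore_deg (a \<odot> w - b \<odot> r) < ore_deg f"
    using \<open>f \<noteq> 0\<close> by (cases "w = 0"; cases "r = 0") (auto simp: ore_deg_less_iff degree_diff_less)
  moreover have "a \<odot> w - b \<odot> r = (a \<odot> k - b \<odot> u) \<odot> f"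
  proof -
    have "a \<odot> w - b \<odot> r = (a \<odot> k - b \<odot> u) \<odot> f + (a \<odot> l - b \<odot> v) \<odot> g"
      unfolding w(1) r by (simp add: ore_ring_simps algebra_simps)
    then show ?thesis
      by (simp add: ab(3))
  qed
  ultimately have ak: "a \<odot> k = b \<odot> u"
    using left_multiple_eq_0[of "a \<odot> k - b \<odot> u" f] by simp
  with \<open>a \<odot> w - b \<odot> r = (a \<odot> k - b \<odot> u) \<odot> f\<close> have aw: "a \<odot> w = b \<odot> r"
    by simp
  \<comment> \<open>Forced: \<open>k = h u\<close> and \<open>l = h v\<close> imply
    \<open>h = h (u x + v y) = k x + l y\<close>.\<close>
  define h where "h = k \<odot> x + l \<odot> y"
  have "b = b \<odot> (u \<odot> x + v \<odot> y)"
    by (simp add: xy)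
  also have "\<dots> = (a \<odot> k) \<odot> x + (a \<odot> l) \<odot> y"
    by (simp add: ak ab(3) ore_mult_add_right ore_mult_assoc)
  also have "\<dots> = a \<odot> h"
    by (simp add: h_def ore_ring_simps)
  finally have "b = a \<odot> h" .
  with ak aw ab(1,3) have "k = h \<odot> u" "l = h \<odot> v" "w = h \<odot> r"
    by (simp_all add: ore_mult_assoc ore_mult_left_cancel)
  then show ?thesis
    unfolding defs by blast
qed

subsection \<open>The key equation\<close>

lemma ore_mult_const_right_add: "p \<odot> [:a + b:] = p \<odot> [:a:] + p \<odot> [:b:]"
  by (metis add_pCons add_0_right ore_mult_add_right)

lemma ore_mult_const_right_sum: "p \<odot> [:sum f A:] = (\<Sum>a\<in>A. p \<odot> [:f a:])"
  by (induction A rule: infinite_finite_induct) (simp_all add: ore_mult_const_right_add)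

text \<open>After exchanging the sums, each error \<open>j\<close> contributes only at position
  \<open>k j\<close>.\<close>

lemma syndrome_of_errors:
  assumes "\<forall>j\<in>J. k j < n"
  shows "syndrome \<sigma> \<delta> n h \<eta> (\<lambda>i. \<Sum>j\<in>J. err j * (if i = k j then 1 else 0)) =
    (\<Sum>j\<in>J. h (k j) \<odot> [:\<eta> (k j) * err j:])"
proof -
  have "syndrome \<sigma> \<delta> n h \<eta> (\<lambda>i. \<Sum>j\<in>J. err j * (if i = k j then 1 else 0)) =
      (\<Sum>i<n. \<Sum>j\<in>J. h i \<odot> [:\<eta> i * (err j * (if i = k j then 1 else 0)):])"
    by (simp only: syndrome_def sum_distrib_left ore_mult_const_right_sum)
  also have "\<dots> = (\<Sum>j\<in>J. \<Sum>i<n. h i \<odot> [:\<eta> i * (err j * (if i = k j then 1 else 0)):])"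
    by (rule sum.swap)
  also have "\<dots> = (\<Sum>j\<in>J. \<Sum>i<n. if i = k j then h i \<odot> [:\<eta> i * err j:] else 0)"
    by (intro sum.cong) auto
  finally show ?thesis
    using assms by simp
qed

lemma syndrome_add:
  "syndrome \<sigma> \<delta> n h \<eta> (\<lambda>i. c i + e i) = syndrome \<sigma> \<delta> n h \<eta> c + syndrome \<sigma> \<delta> n h \<eta> e"
  by (simp add: syndrome_def distrib_left ore_mult_const_right_add sum.distrib)

text \<open>Constant right factors do not raise degrees. The bound makes \<open>g\<close> and the
  syndrome inputs of decreasing degree for the Euclidean algorithm.\<close>

lemma ore_deg_syndrome:
  assumes "\<forall>i<n. ore_deg (h i) < ore_deg g"
  shows "ore_deg (syndrome \<sigma> \<delta> n h \<eta> y) < Fin (degree g)"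
proof -
  have "ore_deg (h i \<odot> [:\<eta> i * y i:]) < Fin (degree g)" if "i < n" for i
    using assms that degree_ore_mult_le[of "h i" "[:\<eta> i * y i:]"]
    by (auto simp: ore_deg_less_iff ore_deg_less_Fin_iff)
  then show ?thesis
    unfolding syndrome_def by (intro ore_deg_sum_less) simp
qed

lemma key_equation_term:
  assumes "ore_invariant \<sigma> \<delta> g" "parity_check_poly \<sigma> \<delta> g a h" "l = \<rho> \<odot> X_minus a"
  shows "\<rho> \<odot> [:b:] - l \<odot> (h \<odot> [:b:]) \<in> left_multiples \<sigma> \<delta> g"
proof -
  obtain p where p: "X_minus a \<odot> h - 1 = p \<odot> g"
    using assms(2) by (auto simp: parity_check_poly_def left_multiples_def)
  have "g \<odot> [:b:] \<in> left_multiples \<sigma> \<delta> g"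
    using assms(1) by (auto simp: ore_invariant_def right_multiples_def)
  \<comment> \<open>Invariance moves \<open>g\<close> to the right of the constant, at the price of
    a new left factor.\<close>
  then obtain b' where b': "g \<odot> [:b:] = b' \<odot> g"
    by (auto simp: left_multiples_def)
  have "\<rho> \<odot> [:b:] - l \<odot> (h \<odot> [:b:]) = - (\<rho> \<odot> ((X_minus a \<odot> h - 1) \<odot> [:b:]))"
    by (simp add: assms(3) ore_ring_simps)
  also have "\<dots> = (- (\<rho> \<odot> (p \<odot> b'))) \<odot> g"
    by (simp add: p b' ore_ring_simps)
  finally show ?thesis
    by (auto simp: left_multiples_def)
qed

lemma left_multiples_sum:
  assumes "\<And>i. i \<in> A \<Longrightarrow> f i \<in> left_multiples \<sigma> \<delta> g"
  shows "sum f A \<in> left_multiples \<sigma> \<delta> g"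
proof -
  have "\<exists>q. \<forall>i\<in>A. f i = q i \<odot> g"
    by (rule bchoice) (use assms in \<open>auto simp: left_multiples_def\<close>)
  then obtain q where "\<And>i. i \<in> A \<Longrightarrow> f i = q i \<odot> g"
    by blast
  then have "sum f A = sum q A \<odot> g"
    by (simp add: ore_mult_sum_left)
  then show ?thesis
    by (auto simp: left_multiples_def)
qed

text \<open>Removing a linear right factor lowers the degree of \<open>l\<close> by one, which makes
  the bound strict.\<close>

lemma ore_deg_evaluator:
  assumes "l \<noteq> 0" "degree l \<le> t" "\<forall>j\<in>J. l = \<rho> j \<odot> X_minus (a j)"
  shows "ore_deg (\<Sum>j\<in>J. \<rho> j \<odot> [:b j:]) < Fin t"
proof (rule ore_deg_sum_less)
  fix j
  assume "j \<in> J"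
  with assms have l: "l = \<rho> j \<odot> X_minus (a j)"
    by blast
  with assms(1) have "\<rho> j \<noteq> 0"
    by auto
  moreover have "X_minus (a j) \<noteq> 0" "degree (X_minus (a j)) = 1"
    by (simp_all add: X_minus_def)
  ultimately have "degree l = degree (\<rho> j) + 1"
    using l degree_ore_mult by metis
  then show "ore_deg (\<rho> j \<odot> [:b j:]) < Fin t"
    using assms(2) degree_ore_mult_le[of "\<rho> j" "[:b j:]"] by (simp add: ore_deg_less_Fin_iff)
qed

end

theorem theorem7:
  fixes \<sigma> \<delta> :: "'a::field \<Rightarrow> 'a"
    and F :: "'a set"
    and n \<nu> t :: nat
    and g s lam \<omega> :: "'a poly"
    and \<alpha> \<eta> c e y err :: "nat \<Rightarrow> 'a"
    and h \<rho> :: "nat \<Rightarrow> 'a poly"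
    and k :: "nat \<Rightarrow> nat"
  assumes "ore_polynomials \<sigma> \<delta>"
    and "is_subfield F"
    and "g \<noteq> 0"
    and "ore_invariant \<sigma> \<delta> g"
    and "inj_on \<alpha> {..<n}"
    and "\<forall>i<n. is_gcrd \<sigma> \<delta> 1 (X_minus (\<alpha> i)) g"
    and "\<forall>i<n. \<eta> i \<noteq> 0"
    and "\<forall>i<n. parity_check_poly \<sigma> \<delta> g (\<alpha> i) (h i)"
    and "c \<in> skew_goppa_code \<sigma> \<delta> F n h \<eta>"
    and "inj_on k {1..\<nu>}"
    and "\<forall>j\<in>{1..\<nu>}. k j < n"
    and "\<forall>j\<in>{1..\<nu>}. err j \<in> F \<and> err j \<noteq> 0"
    and "e = (\<lambda>i. \<Sum>j=1..\<nu>. err j * (if i = k j then 1 else 0))"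
    and "y = (\<lambda>i. c i + e i)"
    and "s = syndrome \<sigma> \<delta> n h \<eta> y"
    and "is_lclm \<sigma> \<delta> lam {X_minus (\<alpha> (k j)) |j. j \<in> {1..\<nu>}}"
    and "\<forall>j\<in>{1..\<nu>}. lam = ore_mult \<sigma> \<delta> (\<rho> (k j)) (X_minus (\<alpha> (k j)))"
    and "\<omega> = (\<Sum>j=1..\<nu>. ore_mult \<sigma> \<delta> (\<rho> (k j)) [:\<eta> (k j) * err j:])"
    and "t = degree g div 2"
  shows "\<exists>\<kappa>. \<omega> = ore_mult \<sigma> \<delta> \<kappa> g + ore_mult \<sigma> \<delta> lam s \<and>
    (\<nu> \<le> t \<longrightarrow>
      (\<exists>!I. is_stop_index \<sigma> \<delta> g s t I) \<and>
      (\<forall>I. is_stop_index \<sigma> \<delta> g s t I \<longrightarrow>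
        (\<exists>h'. \<kappa> = ore_mult \<sigma> \<delta> h' (eea_u \<sigma> \<delta> g s I) \<and>
              lam = ore_mult \<sigma> \<delta> h' (eea_v \<sigma> \<delta> g s I) \<and>
              \<omega> = ore_mult \<sigma> \<delta> h' (eea_r \<sigma> \<delta> g s I))))"
proof -
  interpret ore_polynomials \<sigma> \<delta>
    by fact
  let ?J = "{1..\<nu>}"
  have "syndrome \<sigma> \<delta> n h \<eta> c = 0"
    using \<open>c \<in> skew_goppa_code \<sigma> \<delta> F n h \<eta>\<close> by (simp add: skew_goppa_code_def syndrome_def)
  then have s: "s = (\<Sum>j\<in>?J. h (k j) \<odot> [:\<eta> (k j) * err j:])"
    using \<open>\<forall>j\<in>?J. k j < n\<close>
    unfolding assms(13-15) syndrome_add by (simp add: syndrome_of_errors)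
  have deg_s: "ore_deg s < ore_deg g"
    using ore_deg_syndrome[of n h g] \<open>g \<noteq> 0\<close> \<open>\<forall>i<n. parity_check_poly \<sigma> \<delta> g (\<alpha> i) (h i)\<close>
    unfolding assms(15) by (auto simp: parity_check_poly_def ore_deg_less_iff ore_deg_less_Fin_iff)
  have "\<omega> - lam \<odot> s =
      (\<Sum>j\<in>?J. \<rho> (k j) \<odot> [:\<eta> (k j) * err j:] - lam \<odot> (h (k j) \<odot> [:\<eta> (k j) * err j:]))"
    unfolding s \<open>\<omega> = _\<close> by (simp add: ore_mult_sum_right sum_subtractf)
  also have "\<dots> \<in> left_multiples \<sigma> \<delta> g"
    using assms by (intro left_multiples_sum key_equation_term) auto
  finally obtain \<kappa> where "\<omega> - lam \<odot> s = \<kappa> \<odot> g"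
    by (auto simp: left_multiples_def)
  then have key: "\<omega> = \<kappa> \<odot> g + lam \<odot> s"
    by (simp add: algebra_simps)
  \<comment> \<open>As an image, the family of linear factors fits \<open>degree_lclm_le\<close>,
    and its set of points has at most \<nu> elements.\<close>
  have "is_lclm \<sigma> \<delta> lam (X_minus ` (\<lambda>j. \<alpha> (k j)) ` ?J)"
    using \<open>is_lclm \<sigma> \<delta> lam _\<close> by (simp add: image_image setcompr_eq_image atLeastAtMost_def Int_def)
  then have lam: "lam \<noteq> 0" "degree lam \<le> \<nu>"
    using degree_lclm_le[of lam "(\<lambda>j. \<alpha> (k j)) ` ?J"] card_image_le[of ?J "\<lambda>j. \<alpha> (k j)"]
    by auto
  have "(\<exists>!I. is_stop_index \<sigma> \<delta> g s t I) \<and>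
      (\<forall>I. is_stop_index \<sigma> \<delta> g s t I \<longrightarrow>
        (\<exists>h'. \<kappa> = h' \<odot> eea_u \<sigma> \<delta> g s I \<and> lam = h' \<odot> eea_v \<sigma> \<delta> g s I \<and>
              \<omega> = h' \<odot> eea_r \<sigma> \<delta> g s I))"
    if "\<nu> \<le> t"
  proof (intro conjI allI impI)
    show "\<exists>!I. is_stop_index \<sigma> \<delta> g s t I"
      using stop_index_exists[OF deg_s, of t] stop_index_unique[OF _ _ deg_s] \<open>t = _\<close>
      by (metis div_le_dividend)
    have "ore_deg \<omega> < Fin t"
      unfolding assms(18)
      using lam that assms(17) by (intro ore_deg_evaluator[of lam]) auto
    then show "\<exists>h'. \<kappa> = h' \<odot> eea_u \<sigma> \<delta> g s I \<and> lam = h' \<odot> eea_v \<sigma> \<delta> g s I \<and>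
        \<omega> = h' \<odot> eea_r \<sigma> \<delta> g s I"
      if "is_stop_index \<sigma> \<delta> g s t I" for I
      using eea_recovers_bezout_triple[OF that deg_s _ key] lam \<open>\<nu> \<le> t\<close> \<open>t = _\<close> by simp
  qed
  with key show ?thesis
    by blast
qed

end
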